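(* Let $\mathbb{K}$ be a field and let $m_1,m_2,m_3$ be non-negative integers. The number of dominant monomial ideals in $\mathbb{K}[x,y,z]$ whose lcm is $x^{m_1}y^{m_2}z^{m_3}$ is $$1+m_1^2m_2^2m_3^2+m_1m_2+m_1m_3+m_2m_3+3m_1m_2m_3.$$
   Context: Let $S$ be a polynomial ring over a field in finitely many variables. For a monomial $u$ and a variable $x_i$, $\deg_{x_i}u$ denotes the exponent of $x_i$ in $u$. For a monomial ideal $I$, $G(I)$ denotes its unique minimal set of monomial generators. A monomial $v$ in a finite set $L$ of monomials is dominant in $L$ if there is a variable $x_i$ with $\deg_{x_i}v>\deg_{x_i}w$ for all $w\in L\setminus\{v\}$. The set $L$ is a dominant set if every element of $L$ is dominant in $L$ (in particular, a one-element set is dominant), and $I$ is a dominant ideal if $G(I)$ is a dominant set. The lcm of a nonzero monomial ideal $I$ is the least common multiple of the elements of $G(I)$; the zero ideal is not assigned an lcm and is not counted. *)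

theory Defs
  imports Complex_Main "HOL-Library.Poly_Mapping" "HOL-Library.Numeral_Type"
begin

section \<open>Polynomials, monomials and ideals\<close>

text \<open>
  Exponent vectors are finitely supported functions from the variables to \<^typ>\<open>nat\<close>, and
  polynomials are finitely supported functions from exponent vectors to coefficients, with the
  convolution product. A monomial is represented by its exponent vector \<open>u\<close>;
  \<open>mon u\<close> is the corresponding ring element, and \<open>Poly_Mapping.lookup u i\<close> is the degree of \<open>u\<close>
  in the variable \<open>i\<close>.
\<close>

type_synonym 'v expo = "'v \<Rightarrow>\<^sub>0 nat"
type_synonym ('v, 'k) mpoly = "'v expo \<Rightarrow>\<^sub>0 'k"

abbreviation mon :: "'v expo \<Rightarrow> ('v, 'k::field) mpoly"
  where "mon u \<equiv> Poly_Mapping.single u 1"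

text \<open>
  A commutative ring is a module over itself: its ideals are the submodules, and the ideal
  generated by a set is its span.
\<close>

global_interpretation ideal: module "(*) :: 'a::comm_ring_1 \<Rightarrow> 'a \<Rightarrow> 'a"
  by standard (simp_all add: algebra_simps)

definition monomial_ideal :: "('v::finite, 'k::field) mpoly set \<Rightarrow> bool"
  where "monomial_ideal I \<longleftrightarrow> (\<exists>U. I = ideal.span (mon ` U))"

definition minimal_gens :: "'v::finite expo set \<Rightarrow> ('v, 'k::field) mpoly set \<Rightarrow> bool"
  where "minimal_gens U I \<longleftrightarrow>
    ideal.span (mon ` U) = I \<and> (\<forall>V. V \<subset> U \<longrightarrow> ideal.span (mon ` V) \<noteq> I)"

text \<open>Meaningful for monomial ideals only; see \<open>ex1_minimal_gens\<close> below.\<close>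

definition gens :: "('v::finite, 'k::field) mpoly set \<Rightarrow> 'v expo set"
  where "gens I = (THE U. minimal_gens U I)"

section \<open>Dominance and least common multiples\<close>

definition dominant_in :: "'v::finite expo \<Rightarrow> 'v expo set \<Rightarrow> bool"
  where "dominant_in v L \<longleftrightarrow> v \<in> L \<and> (\<exists>i. \<forall>w \<in> L - {v}. Poly_Mapping.lookup v i > Poly_Mapping.lookup w i)"

text \<open>
  Finiteness of \<open>L\<close> need not be required: distinct dominant elements need distinct variables,
  so that dominant sets are finite.
\<close>

definition dominant_set :: "'v::finite expo set \<Rightarrow> bool"
  where "dominant_set L \<longleftrightarrow> (\<forall>v \<in> L. dominant_in v L)"

definition dominant_ideal :: "('v::finite, 'k::field) mpoly set \<Rightarrow> bool"
  where "dominant_ideal I \<longleftrightarrow> monomial_ideal I \<and> dominant_set (gens I)"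

definition is_lcm :: "'a::comm_semiring_1 set \<Rightarrow> 'a \<Rightarrow> bool"
  where "is_lcm A m \<longleftrightarrow> (\<forall>a \<in> A. a dvd m) \<and> (\<forall>f. (\<forall>a \<in> A. a dvd f) \<longrightarrow> m dvd f)"

text \<open>
  The zero ideal has no lcm. It has to be excluded explicitly, since its generating set is
  empty and \<open>1\<close> is an lcm of the empty set.
\<close>

definition ideal_has_lcm :: "('v::finite, 'k::field) mpoly set \<Rightarrow> 'v expo \<Rightarrow> bool"
  where "ideal_has_lcm I m \<longleftrightarrow> I \<noteq> {0} \<and> is_lcm (mon ` gens I :: ('v, 'k) mpoly set) (mon m)"

section \<open>The minimal set of monomial generators is well defined\<close>

lemma keys_in_span_mon:
  assumes "f \<in> ideal.span (mon ` U :: ('v::finite, 'k::field) mpoly set)" and "t \<in> Poly_Mapping.keys f"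
  shows "\<exists>u\<in>U. \<exists>s. t = u + s"
proof -
  let ?S = "{f :: ('v, 'k) mpoly. \<forall>t\<in>Poly_Mapping.keys f. \<exists>u\<in>U. \<exists>s. t = u + s}"
  have "ideal.subspace ?S"
  proof (rule ideal.subspaceI)
    show "x + y \<in> ?S" if "x \<in> ?S" "y \<in> ?S" for x y
      using that Poly_Mapping.keys_add[of x y] by blast
    show "c * x \<in> ?S" if x: "x \<in> ?S" for c x
    proof (clarify)
      fix t assume "t \<in> Poly_Mapping.keys (c * x)"
      then obtain a b where ab: "t = a + b" "b \<in> Poly_Mapping.keys x"
        using keys_mult[of c x] by blast
      then obtain u s where "u \<in> U" "b = u + s" using x by blast
      then have "t = u + (a + s)" using ab by (simp add: algebra_simps)
      with \<open>u \<in> U\<close> show "\<exists>u\<in>U. \<exists>s. t = u + s" by blast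
    qed
  qed simp
  moreover have "mon ` U \<subseteq> ?S"
    by auto (metis add_0_right)
  ultimately have "ideal.span (mon ` U) \<subseteq> ?S"
    by (rule ideal.span_minimal[rotated])
  then show ?thesis using assms by blast
qed

lemma mon_in_span_mon_iff:
  "(mon t :: ('v::finite, 'k::field) mpoly) \<in> ideal.span (mon ` U) \<longleftrightarrow> (\<exists>u\<in>U. \<exists>s. t = u + s)"
proof
  assume "(mon t :: ('v, 'k) mpoly) \<in> ideal.span (mon ` U)"
  then show "\<exists>u\<in>U. \<exists>s. t = u + s" by (rule keys_in_span_mon) simp
next
  assume "\<exists>u\<in>U. \<exists>s. t = u + s"
  then obtain u s where *: "u \<in> U" "t = u + s" by blast
  have "(mon s * mon u :: ('v, 'k) mpoly) \<in> ideal.span (mon ` U)"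
    using * by (intro ideal.span_scale ideal.span_base) auto
  then show "(mon t :: ('v, 'k) mpoly) \<in> ideal.span (mon ` U)"
    by (simp add: * mult_single add.commute)
qed

lemma expo_antisym:
  fixes u v :: "'v expo"
  assumes "u = v + s" "v = u + r"
  shows "u = v"
proof -
  have "u = u + (r + s)" using assms by (metis add.assoc)
  then have "r + s = 0" by simp
  then have "Poly_Mapping.lookup r i + Poly_Mapping.lookup s i = 0" for i by (metis lookup_add lookup_zero)
  then have "s = 0" by (intro poly_mapping_eqI) (metis add_is_0 lookup_zero)
  then show ?thesis using assms by simp
qed

lemma expo_minimal_below:
  fixes U :: "'v::finite expo set"
  assumes "u \<in> U"
  shows "\<exists>v\<in>U. (\<exists>s. u = v + s) \<and> (\<forall>w\<in>U. \<forall>r. v = w + r \<longrightarrow> w = v)"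
  using assms
proof (induction "\<Sum>i\<in>UNIV. Poly_Mapping.lookup u i" arbitrary: u rule: less_induct)
  case less
  show ?case
  proof (cases "\<forall>w\<in>U. \<forall>r. u = w + r \<longrightarrow> w = u")
    case True
    then show ?thesis using less.prems by (metis add_0_right)
  next
    case False
    then obtain w r where w: "w \<in> U" "u = w + r" "w \<noteq> u" by blast
    then have "r \<noteq> 0" by auto
    then obtain i where "Poly_Mapping.lookup r i \<noteq> 0" by (metis lookup_zero poly_mapping_eqI)
    then have "(\<Sum>i\<in>UNIV. Poly_Mapping.lookup r i) > 0"
      by (metis UNIV_I finite gr0I sum_eq_0_iff)
    then have "(\<Sum>i\<in>UNIV. Poly_Mapping.lookup w i) < (\<Sum>i\<in>UNIV. Poly_Mapping.lookup u i)"
      by (simp add: w lookup_add sum.distrib)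
    from less.hyps[OF this w(1)] show ?thesis using w(2) by (metis add.assoc)
  qed
qed

lemma ex1_minimal_gens:
  fixes I :: "('v::finite, 'k::field) mpoly set"
  assumes "monomial_ideal I"
  shows "\<exists>!U. minimal_gens U I"
proof -
  obtain W where I: "I = ideal.span (mon ` W)" using assms by (auto simp: monomial_ideal_def)
  define M where "M = {v \<in> W. \<forall>w\<in>W. \<forall>r. v = w + r \<longrightarrow> w = v}"
  have M_sub: "M \<subseteq> U" if U: "ideal.span (mon ` U) = I" for U
  proof
    fix v assume v: "v \<in> M"
    then have "mon v \<in> ideal.span (mon ` U :: ('v, 'k) mpoly set)"
      unfolding U I M_def by (auto intro: ideal.span_base)
    then obtain u s where u: "u \<in> U" "v = u + s" using mon_in_span_mon_iff by blast
    then have "mon u \<in> ideal.span (mon ` W :: ('v, 'k) mpoly set)"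
      using U I by (metis ideal.span_base image_eqI)
    then obtain w r where w: "w \<in> W" "u = w + r" using mon_in_span_mon_iff by blast
    then have "w = v" using v u unfolding M_def by (auto simp: add.assoc)
    then have "u = v" using expo_antisym u(2) w(2) by metis
    then show "v \<in> U" using u by simp
  qed
  have M_gen: "ideal.span (mon ` M) = I"
  proof
    show "ideal.span (mon ` M) \<subseteq> I"
      unfolding I by (intro ideal.span_mono image_mono) (auto simp: M_def)
    have "mon ` W \<subseteq> ideal.span (mon ` M :: ('v, 'k) mpoly set)"
    proof clarify
      fix u assume "u \<in> W"
      then show "mon u \<in> ideal.span (mon ` M :: ('v, 'k) mpoly set)"
        unfolding mon_in_span_mon_iff M_def using expo_minimal_below[of u W] by blast
    qed
    then show "I \<subseteq> ideal.span (mon ` M)"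
      unfolding I by (rule ideal.span_minimal) simp
  qed
  show ?thesis
  proof (rule ex1I)
    show "minimal_gens M I" using M_gen M_sub by (auto simp: minimal_gens_def)
    show "U = M" if "minimal_gens U I" for U
      using that M_gen M_sub[of U] unfolding minimal_gens_def by blast
  qed
qed

end

theory Submission
  imports Defs
begin

text \<open>
  A dominant set is the minimal generating set of the ideal it generates, so one counts nonempty
  dominant sets of exponent vectors whose componentwise maximum is \<open>(m1, m2, m3)\<close>. Distinct elements
  of a dominant set dominate in distinct variables, so such a set has at most three elements.
  There is one singleton. In a two-element set the coordinatewise comparison of the two vectors has
  both signs; ordering the vectors so that the first nonzero sign is positive makes the count a sum
  of products. In a three-element set each vector takes the maximal value in exactly one variable,
  and the two other values of that variable are arbitrary smaller numbers, which gives
  \<open>m1\<^sup>2 m2\<^sup>2 m3\<^sup>2\<close> sets.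
\<close>

section \<open>Divisibility by monomials\<close>

lemma expo_le_iff:
  fixes a t :: "'v expo"
  shows "(\<exists>s. t = a + s) \<longleftrightarrow> (\<forall>i. Poly_Mapping.lookup a i \<le> Poly_Mapping.lookup t i)"
proof
  assume "\<forall>i. Poly_Mapping.lookup a i \<le> Poly_Mapping.lookup t i"
  then have "t = a + (t - a)"
    by (intro poly_mapping_eqI) (simp add: lookup_add lookup_minus)
  then show "\<exists>s. t = a + s" ..
qed (auto simp: lookup_add)

text \<open>A multiple of \<open>mon a\<close> lies in the ideal generated by \<open>mon a\<close>,
  so \<open>keys_in_span_mon\<close> bounds its exponents. Conversely, \<open>f\<close> is the sum
  of its terms, and each of them is divisible.\<close>

lemma mon_dvd_iff:
  fixes f :: "('v::finite, 'k::field) mpoly"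
  shows "mon a dvd f \<longleftrightarrow>
    (\<forall>t\<in>Poly_Mapping.keys f. \<forall>i. Poly_Mapping.lookup a i \<le> Poly_Mapping.lookup t i)"
proof
  assume "mon a dvd f"
  then obtain g where "f = g * mon a" by (metis dvdE mult.commute)
  then have "f \<in> ideal.span (mon ` {a})"
    by (auto intro: ideal.span_scale ideal.span_base)
  from keys_in_span_mon[OF this]
  show "\<forall>t\<in>Poly_Mapping.keys f. \<forall>i. Poly_Mapping.lookup a i \<le> Poly_Mapping.lookup t i"
    by (metis expo_le_iff singletonD)
next
  assume le: "\<forall>t\<in>Poly_Mapping.keys f. \<forall>i. Poly_Mapping.lookup a i \<le> Poly_Mapping.lookup t i"
  have f: "f = (\<Sum>t\<in>Poly_Mapping.keys f. Poly_Mapping.single t (Poly_Mapping.lookup f t))"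
    by (rule poly_mapping_eqI) (auto simp: lookup_sum lookup_single when_def in_keys_iff)
  have "mon a dvd Poly_Mapping.single t (Poly_Mapping.lookup f t)"
    if t: "t \<in> Poly_Mapping.keys f" for t
  proof -
    obtain s where "t = a + s" using le t expo_le_iff by metis
    then have "Poly_Mapping.single t (Poly_Mapping.lookup f t) =
        mon a * Poly_Mapping.single s (Poly_Mapping.lookup f t)"
      by (simp add: mult_single)
    then show ?thesis by simp
  qed
  then show "mon a dvd f" by (subst f) (rule dvd_sum)
qed

definition is_sup :: "'v expo set \<Rightarrow> 'v expo \<Rightarrow> bool"
  where "is_sup L m \<longleftrightarrow>
    (\<forall>i. (\<forall>u\<in>L. Poly_Mapping.lookup u i \<le> Poly_Mapping.lookup m i) \<and>
         (\<exists>u\<in>L. Poly_Mapping.lookup u i = Poly_Mapping.lookup m i))"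

text \<open>\<open>is_lcm\<close> tests against all polynomials, but divisibility by a monomial is
  decided term by term, so only exponents matter.\<close>

lemma is_lcm_mon_iff:
  fixes L :: "'v::finite expo set"
  assumes "L \<noteq> {}"
  shows "is_lcm (mon ` L :: ('v, 'k::field) mpoly set) (mon m) \<longleftrightarrow> is_sup L m"
proof
  assume lcm: "is_lcm (mon ` L :: ('v, 'k) mpoly set) (mon m)"
  have le: "Poly_Mapping.lookup u i \<le> Poly_Mapping.lookup m i" if "u \<in> L" for u i
    using lcm that by (auto simp: is_lcm_def mon_dvd_iff)
  have "\<exists>u\<in>L. Poly_Mapping.lookup u i = Poly_Mapping.lookup m i" for i
  proof (rule ccontr)
    assume "\<not> ?thesis"
    with le have less: "Poly_Mapping.lookup u i < Poly_Mapping.lookup m i" if "u \<in> L" for u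
      using that by (metis le_neq_implies_less)
    \<comment> \<open>Lowering the unattained exponent by one leaves a common multiple that
      \<open>mon m\<close> cannot divide.\<close>
    define m' where "m' = Poly_Mapping.update i (Poly_Mapping.lookup m i - 1) m"
    have "\<forall>u\<in>L. (mon u :: ('v, 'k) mpoly) dvd mon m'"
      using le less by (force simp: mon_dvd_iff m'_def lookup_update)
    then have "(mon m :: ('v, 'k) mpoly) dvd mon m'"
      using lcm by (auto simp: is_lcm_def)
    then have "Poly_Mapping.lookup m i \<le> Poly_Mapping.lookup m i - 1"
      by (auto simp: mon_dvd_iff m'_def lookup_update dest: spec[of _ i])
    \<comment> \<open>Any element of the nonempty \<open>L\<close> shows that the exponent of
      \<open>m\<close> at \<open>i\<close> is positive, so the truncated subtraction really lowers
      it.\<close>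
    then show False using assms less by fastforce
  qed
  then show "is_sup L m" using le by (auto simp: is_sup_def)
next
  assume sup: "is_sup L m"
  have "(mon m :: ('v, 'k) mpoly) dvd f" if f: "\<forall>u\<in>L. mon u dvd f" for f :: "('v, 'k) mpoly"
    unfolding mon_dvd_iff
  proof (intro ballI allI)
    fix t i assume t: "t \<in> Poly_Mapping.keys f"
    obtain u where "u \<in> L" "Poly_Mapping.lookup u i = Poly_Mapping.lookup m i"
      using sup unfolding is_sup_def by blast
    then show "Poly_Mapping.lookup m i \<le> Poly_Mapping.lookup t i"
      using f t unfolding mon_dvd_iff by metis
  qed
  then show "is_lcm (mon ` L :: ('v, 'k) mpoly set) (mon m)"
    using sup by (simp add: is_lcm_def is_sup_def mon_dvd_iff)
qed

section \<open>Dominant ideals and dominant sets\<close>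

text \<open>A generator missing from \<open>V\<close> would be a multiple of some \<open>v\<close>
  in \<open>V\<close>, but \<open>v\<close> exceeds it in the variable where \<open>v\<close>
  dominates.\<close>

lemma minimal_gens_dominant_set:
  assumes "dominant_set L"
  shows "minimal_gens L (ideal.span (mon ` L) :: ('v::finite, 'k::field) mpoly set)"
  unfolding minimal_gens_def
proof (intro conjI allI impI notI refl)
  fix V assume V: "V \<subset> L"
    and eq: "ideal.span (mon ` V) = (ideal.span (mon ` L) :: ('v, 'k) mpoly set)"
  obtain u where u: "u \<in> L" "u \<notin> V" using V by blast
  then have "(mon u :: ('v, 'k) mpoly) \<in> ideal.span (mon ` V)"
    unfolding eq by (auto intro: ideal.span_base)
  then obtain v where v: "v \<in> V"
    and le: "\<forall>i. Poly_Mapping.lookup v i \<le> Poly_Mapping.lookup u i"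
    using mon_in_span_mon_iff expo_le_iff by metis
  have "dominant_in v L" using assms v V by (auto simp: dominant_set_def)
  then obtain i where "Poly_Mapping.lookup u i < Poly_Mapping.lookup v i"
    using u v unfolding dominant_in_def by blast
  then show False using le by (simp add: leD)
qed

lemma gens_span_dominant_set:
  assumes "dominant_set L"
  shows "gens (ideal.span (mon ` L) :: ('v::finite, 'k::field) mpoly set) = L"
  unfolding gens_def
proof (rule the1_equality)
  show "\<exists>!U. minimal_gens U (ideal.span (mon ` L) :: ('v, 'k) mpoly set)"
    by (rule ex1_minimal_gens) (auto simp: monomial_ideal_def)
qed (rule minimal_gens_dominant_set[OF assms])

lemma span_gens:
  assumes "monomial_ideal I"
  shows "ideal.span (mon ` gens I) = I"
proof -
  have "minimal_gens (gens I) I"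
    unfolding gens_def by (rule theI'[OF ex1_minimal_gens[OF assms]])
  then show ?thesis unfolding minimal_gens_def by (rule conjunct1)
qed

lemma span_mon_eq_zero_iff:
  "ideal.span (mon ` L) = ({0} :: ('v::finite, 'k::field) mpoly set) \<longleftrightarrow> L = {}"
proof
  assume "ideal.span (mon ` L) = ({0} :: ('v, 'k) mpoly set)"
  then have "(mon u :: ('v, 'k) mpoly) = 0" if "u \<in> L" for u
    using that by (metis ideal.span_base imageI singletonD)
  then show "L = {}" by (metis all_not_in_conv lookup_single_eq lookup_zero zero_neq_one)
qed simp

definition dominant_sets :: "'v::finite expo \<Rightarrow> 'v expo set set"
  where "dominant_sets m = {L. L \<noteq> {} \<and> dominant_set L \<and> is_sup L m}"

text \<open>On dominant sets \<open>gens\<close> is a left inverse of the span, and every dominant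
  ideal is the span of its generators; so the two kinds of objects correspond bijectively.\<close>

lemma card_dominant_ideals:
  "card {I :: ('v::finite, 'k::field) mpoly set. dominant_ideal I \<and> ideal_has_lcm I m} =
    card (dominant_sets m)"
proof -
  let ?span = "\<lambda>L. ideal.span (mon ` L) :: ('v, 'k) mpoly set"
  have has_lcm: "ideal_has_lcm (?span L) m \<longleftrightarrow> L \<noteq> {} \<and> is_sup L m" if "dominant_set L" for L
    using that is_lcm_mon_iff[of L m]
    by (auto simp: ideal_has_lcm_def span_mon_eq_zero_iff gens_span_dominant_set)
  have "{I. dominant_ideal I \<and> ideal_has_lcm I m} = ?span ` dominant_sets m"
  proof (intro equalityI subsetI)
    fix I :: "('v, 'k) mpoly set"
    assume "I \<in> {I. dominant_ideal I \<and> ideal_has_lcm I m}"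
    then have "I = ?span (gens I)" "dominant_set (gens I)" "ideal_has_lcm I m"
      by (simp_all add: dominant_ideal_def span_gens)
    then show "I \<in> ?span ` dominant_sets m"
      using has_lcm[of "gens I"] by (auto simp: dominant_sets_def)
  next
    fix I
    assume "I \<in> ?span ` dominant_sets m"
    then obtain L where L: "L \<in> dominant_sets m" and I: "I = ?span L" ..
    then have dom: "dominant_set L" by (simp add: dominant_sets_def)
    then have "dominant_ideal I"
      unfolding dominant_ideal_def monomial_ideal_def I by (metis gens_span_dominant_set)
    moreover have "ideal_has_lcm I m"
      unfolding I has_lcm[OF dom] using L by (simp add: dominant_sets_def)
    ultimately show "I \<in> {I. dominant_ideal I \<and> ideal_has_lcm I m}" by simp
  qed
  moreover have "inj_on ?span (dominant_sets m)"
    by (rule inj_on_inverseI[where g = gens]) (simp add: dominant_sets_def gens_span_dominant_set)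
  ultimately show ?thesis by (simp add: card_image)
qed

section \<open>Exponent vectors in three variables\<close>

lemma exhaust_type3: "i = 0 \<or> i = 1 \<or> i = 2" for i :: 3
proof (cases i)
  case (of_int z)
  then have "z = 0 \<or> z = 1 \<or> z = 2" by auto
  then show ?thesis using of_int by auto
qed

lemma all_type3: "(\<forall>i :: 3. P i) \<longleftrightarrow> P 0 \<and> P 1 \<and> P 2"
  by (metis exhaust_type3)

lemma ex_type3: "(\<exists>i :: 3. P i) \<longleftrightarrow> P 0 \<or> P 1 \<or> P 2"
  by (metis exhaust_type3)

text \<open>The same sum of \<open>single\<close> terms as in the final theorem, which can thus be
  folded.\<close>

definition vec :: "nat \<Rightarrow> nat \<Rightarrow> nat \<Rightarrow> 3 expo"
  where "vec a b c = Poly_Mapping.single 0 a + Poly_Mapping.single 1 b + Poly_Mapping.single 2 c"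

lemma lookup_vec [simp]:
  "Poly_Mapping.lookup (vec a b c) 0 = a"
  "Poly_Mapping.lookup (vec a b c) 1 = b"
  "Poly_Mapping.lookup (vec a b c) 2 = c"
  by (simp_all add: vec_def lookup_add lookup_single)

lemma vec_eq_iff [simp]: "vec a b c = vec a' b' c' \<longleftrightarrow> a = a' \<and> b = b' \<and> c = c'"
  by (metis lookup_vec)

lemma vec_lookup:
  "u = vec (Poly_Mapping.lookup u 0) (Poly_Mapping.lookup u 1) (Poly_Mapping.lookup u 2)"
proof (rule poly_mapping_eqI)
  fix i :: 3
  show "Poly_Mapping.lookup u i = Poly_Mapping.lookup
      (vec (Poly_Mapping.lookup u 0) (Poly_Mapping.lookup u 1) (Poly_Mapping.lookup u 2)) i"
    using exhaust_type3[of i] by auto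
qed

lemma expo3_cases:
  fixes u :: "3 expo"
  obtains a b c where "u = vec a b c"
  using vec_lookup by blast

section \<open>Counting dominant sets\<close>

text \<open>
  In \<open>((u1, v1), (u2, v2), (u3, v3))\<close> the \<open>i\<close>-th pair holds the \<open>i\<close>-th coordinates of two vectors
  \<open>u\<close> and \<open>v\<close>, where \<open>u\<close> is the larger one in the first variable in which they differ. The three
  parts are: \<open>v\<close> wins in the second variable; \<open>v\<close> wins in the third variable only; \<open>u\<close> and \<open>v\<close>
  agree in the first variable.
\<close>

definition pair_boxes :: "nat \<Rightarrow> nat \<Rightarrow> nat \<Rightarrow> ((nat \<times> nat) \<times> (nat \<times> nat) \<times> (nat \<times> nat)) set"
  where "pair_boxes a b c =
    ({a} \<times> {..<a}) \<times> ({..<b} \<times> {b}) \<times> ({c} \<times> {..c} \<union> {..<c} \<times> {c}) \<union>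
    ({a} \<times> {..<a}) \<times> ({b} \<times> {..b}) \<times> ({..<c} \<times> {c}) \<union>
    {(a, a)} \<times> ({b} \<times> {..<b}) \<times> ({..<c} \<times> {c})"

definition pair_set :: "(nat \<times> nat) \<times> (nat \<times> nat) \<times> (nat \<times> nat) \<Rightarrow> 3 expo set"
  where "pair_set = (\<lambda>((u1, v1), (u2, v2), (u3, v3)). {vec u1 u2 u3, vec v1 v2 v3})"

text \<open>The \<open>i\<close>-th pair holds the \<open>i\<close>-th coordinates of the two
  vectors that do not dominate in variable \<open>i\<close>.\<close>

definition triple_box :: "nat \<Rightarrow> nat \<Rightarrow> nat \<Rightarrow> ((nat \<times> nat) \<times> (nat \<times> nat) \<times> (nat \<times> nat)) set"
  where "triple_box a b c = ({..<a} \<times> {..<a}) \<times> ({..<b} \<times> {..<b}) \<times> ({..<c} \<times> {..<c})"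

definition triple_set ::
    "nat \<Rightarrow> nat \<Rightarrow> nat \<Rightarrow> (nat \<times> nat) \<times> (nat \<times> nat) \<times> (nat \<times> nat) \<Rightarrow> 3 expo set"
  where "triple_set a b c =
    (\<lambda>((q1, r1), (p2, r2), (p3, q3)). {vec a p2 p3, vec q1 b q3, vec r1 r2 c})"

lemma mem_pair_boxes_iff:
  "((u1, v1), (u2, v2), (u3, v3)) \<in> pair_boxes a b c \<longleftrightarrow>
    max u1 v1 = a \<and> max u2 v2 = b \<and> max u3 v3 = c \<and>
    (v1 < u1 \<and> (u2 < v2 \<or> u3 < v3) \<or> u1 = v1 \<and> v2 < u2 \<and> u3 < v3)"
proof -
  have "(u, v) \<in> {n} \<times> {..<n} \<longleftrightarrow> max u v = n \<and> v < u"
    "(u, v) \<in> {..<n} \<times> {n} \<longleftrightarrow> max u v = n \<and> u < v"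
    "(u, v) \<in> {n} \<times> {..n} \<longleftrightarrow> max u v = n \<and> \<not> u < v"
    "(u, v) \<in> {(n, n)} \<longleftrightarrow> max u v = n \<and> u = v"
    "(u, v) \<in> {n} \<times> {..n} \<union> {..<n} \<times> {n} \<longleftrightarrow> max u v = n"
    for u v n :: nat
    by (auto simp: max_def)
  \<comment> \<open>Only nested tuples are unfolded, so that the facts above can rewrite the
    memberships of pairs of numbers.\<close>
  then show ?thesis
    unfolding pair_boxes_def Un_iff[of "(_, _, _)"] mem_Times_iff[of "(_, _, _)"] fst_conv snd_conv
      mem_Times_iff[of "((_, _), _, _)"]
    by (simp only:) blast
qed

lemma finite_pair_boxes: "finite (pair_boxes a b c)"
  by (simp add: pair_boxes_def)

text \<open>The three parts contribute \<open>a * b * (2 * c + 1)\<close>,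
  \<open>a * (b + 1) * c\<close> and \<open>b * c\<close>.\<close>

lemma card_pair_boxes: "card (pair_boxes a b c) = a * b + a * c + b * c + 3 * a * b * c"
proof -
  have "card ({c} \<times> {..c} \<union> {..<c} \<times> {c}) = 2 * c + 1"
    by (subst card_Un_disjoint) (auto simp: card_cartesian_product)
  then show ?thesis
    unfolding pair_boxes_def
    by (subst card_Un_disjoint; (subst card_Un_disjoint)?)
      (auto simp: card_cartesian_product algebra_simps)
qed

text \<open>The unordered pair determines its order: the first differing coordinate is larger in the
  first vector, which rules out a swap.\<close>

lemma inj_on_pair_set: "inj_on pair_set (pair_boxes a b c)"
  by (rule inj_onI) (auto simp: pair_set_def pair_boxes_def doubleton_eq_iff)

lemma card_pair_set: "x \<in> pair_boxes a b c \<Longrightarrow> card (pair_set x) = 2"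
  by (auto simp: pair_set_def pair_boxes_def card_insert_if)

lemma finite_triple_box: "finite (triple_box a b c)"
  by (simp add: triple_box_def)

lemma card_triple_box: "card (triple_box a b c) = a\<^sup>2 * b\<^sup>2 * c\<^sup>2"
  by (simp add: triple_box_def card_cartesian_product power2_eq_square)

text \<open>Each vector is recognisable in the set as the only one reaching the bound in its own
  variable.\<close>

lemma inj_on_triple_set: "inj_on (triple_set a b c) (triple_box a b c)"
proof (rule inj_onI)
  fix x y
  assume x: "x \<in> triple_box a b c" and y: "y \<in> triple_box a b c"
    and eq: "triple_set a b c x = triple_set a b c y"
  obtain q1 r1 p2 r2 p3 q3 where xs: "x = ((q1, r1), (p2, r2), (p3, q3))"
    by (metis surj_pair)
  obtain q1' r1' p2' r2' p3' q3' where ys: "y = ((q1', r1'), (p2', r2'), (p3', q3'))"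
    by (metis surj_pair)
  have "vec a p2 p3 \<in> triple_set a b c y" "vec q1 b q3 \<in> triple_set a b c y"
    "vec r1 r2 c \<in> triple_set a b c y"
    unfolding eq[symmetric] by (simp_all add: xs triple_set_def)
  then show "x = y" using x y by (auto simp: xs ys triple_set_def triple_box_def)
qed

lemma card_triple_set: "x \<in> triple_box a b c \<Longrightarrow> card (triple_set a b c x) = 3"
  by (auto simp: triple_set_def triple_box_def card_insert_if)

section \<open>Dominance and the variables that witness it\<close>

lemma dominant_set_singleton: "dominant_set {u}"
  by (simp add: dominant_set_def dominant_in_def)

lemma dominant_set_pair_iff:
  assumes "u \<noteq> v"
  shows "dominant_set {u, v} \<longleftrightarrow>
    (\<exists>i. Poly_Mapping.lookup v i < Poly_Mapping.lookup u i) \<and>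
    (\<exists>i. Poly_Mapping.lookup u i < Poly_Mapping.lookup v i)"
  using assms by (auto simp: dominant_set_def dominant_in_def insert_Diff_if)

text \<open>Two elements dominating in the same variable would each exceed the other there.
  Injectivity of \<open>d\<close> bounds the size of \<open>L\<close> by the number of
  variables.\<close>

lemma dominant_set_variables:
  fixes L :: "'v::finite expo set"
  assumes "dominant_set L"
  obtains d where "inj_on d L"
    "\<And>v w. v \<in> L \<Longrightarrow> w \<in> L \<Longrightarrow> w \<noteq> v \<Longrightarrow>
      Poly_Mapping.lookup w (d v) < Poly_Mapping.lookup v (d v)"
proof -
  obtain d where d: "\<forall>v\<in>L. \<forall>w\<in>L - {v}. Poly_Mapping.lookup w (d v) < Poly_Mapping.lookup v (d v)"
    using assms unfolding dominant_set_def dominant_in_def by metis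
  have "inj_on d L"
    by (rule inj_onI) (metis Diff_iff d not_less_iff_gr_or_eq singletonD)
  then show ?thesis using that d by blast
qed

lemma pair_set_in_dominant_sets:
  assumes "x \<in> pair_boxes a b c"
  shows "pair_set x \<in> dominant_sets (vec a b c)"
proof -
  obtain u1 v1 u2 v2 u3 v3 where x: "x = ((u1, v1), (u2, v2), (u3, v3))"
    by (metis surj_pair)
  have mem: "max u1 v1 = a" "max u2 v2 = b" "max u3 v3 = c"
    "v1 < u1 \<and> (u2 < v2 \<or> u3 < v3) \<or> u1 = v1 \<and> v2 < u2 \<and> u3 < v3"
    using assms unfolding x mem_pair_boxes_iff by blast+
  have neq: "vec u1 u2 u3 \<noteq> vec v1 v2 v3" using mem(4) by auto
  have "dominant_set {vec u1 u2 u3, vec v1 v2 v3}"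
    unfolding dominant_set_pair_iff[OF neq] ex_type3 lookup_vec using mem(4) by blast
  moreover have "is_sup {vec u1 u2 u3, vec v1 v2 v3} (vec a b c)"
    using mem(1-3) by (simp add: is_sup_def all_type3) linarith
  ultimately show ?thesis by (simp add: dominant_sets_def pair_set_def x)
qed

lemma triple_set_in_dominant_sets:
  assumes "x \<in> triple_box a b c"
  shows "triple_set a b c x \<in> dominant_sets (vec a b c)"
proof -
  obtain q1 r1 p2 r2 p3 q3 where x: "x = ((q1, r1), (p2, r2), (p3, q3))"
    by (metis surj_pair)
  have less: "q1 < a" "r1 < a" "p2 < b" "r2 < b" "p3 < c" "q3 < c"
    using assms by (simp_all add: x triple_box_def)
  let ?L = "{vec a p2 p3, vec q1 b q3, vec r1 r2 c}"
  have "dominant_in (vec a p2 p3) ?L"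
    unfolding dominant_in_def using less by (intro conjI exI[of _ 0]) auto
  moreover have "dominant_in (vec q1 b q3) ?L"
    unfolding dominant_in_def using less by (intro conjI exI[of _ 1]) auto
  moreover have "dominant_in (vec r1 r2 c) ?L"
    unfolding dominant_in_def using less by (intro conjI exI[of _ 2]) auto
  moreover have "is_sup ?L (vec a b c)"
    using less by (simp add: is_sup_def all_type3)
  ultimately show ?thesis by (simp add: dominant_sets_def dominant_set_def triple_set_def x)
qed

lemma pair_in_dominant_setsD:
  assumes L: "{u, v} \<in> dominant_sets (vec a b c)" and "u \<noteq> v"
  shows "{u, v} \<in> pair_set ` pair_boxes a b c"
proof -
  obtain u1 u2 u3 where u: "u = vec u1 u2 u3" by (rule expo3_cases)
  obtain v1 v2 v3 where v: "v = vec v1 v2 v3" by (rule expo3_cases)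
  have sup: "max u1 v1 = a" "max u2 v2 = b" "max u3 v3 = c"
    using L by (auto simp: dominant_sets_def is_sup_def all_type3 u v)
  have dom: "v1 < u1 \<or> v2 < u2 \<or> v3 < u3" "u1 < v1 \<or> u2 < v2 \<or> u3 < v3"
    using L \<open>u \<noteq> v\<close> by (auto simp: dominant_sets_def dominant_set_pair_iff ex_type3 u v)
  \<comment> \<open>If the first coordinates agree, the second ones differ, since the third alone
    cannot supply both strict inequalities; this fixes the order.\<close>
  have "((u1, v1), (u2, v2), (u3, v3)) \<in> pair_boxes a b c \<or>
      ((v1, u1), (v2, u2), (v3, u3)) \<in> pair_boxes a b c"
    using sup dom by (cases u1 v1 rule: linorder_cases) (auto simp: mem_pair_boxes_iff max.commute)
  moreover have "{u, v} = pair_set ((u1, v1), (u2, v2), (u3, v3))"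
    "{u, v} = pair_set ((v1, u1), (v2, u2), (v3, u3))"
    by (auto simp: pair_set_def u v)
  ultimately show ?thesis by (metis imageI)
qed

section \<open>Classification and final count\<close>

lemma dominant_sets_vec:
  "dominant_sets (vec a b c) =
    {{vec a b c}} \<union> pair_set ` pair_boxes a b c \<union> triple_set a b c ` triple_box a b c"
proof (intro equalityI subsetI)
  fix L assume L: "L \<in> dominant_sets (vec a b c)"
  then have "L \<noteq> {}" and dom: "dominant_set L" and sup: "is_sup L (vec a b c)"
    by (simp_all add: dominant_sets_def)
  obtain d where inj: "inj_on d L"
    and d: "\<And>v w. v \<in> L \<Longrightarrow> w \<in> L \<Longrightarrow> w \<noteq> v \<Longrightarrow>
      Poly_Mapping.lookup w (d v) < Poly_Mapping.lookup v (d v)"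
    using dominant_set_variables[OF dom] by metis
  have fin: "finite L" using inj by (rule inj_on_finite) auto
  have "card L \<le> CARD(3)" using inj by (rule card_inj_on_le) auto
  moreover have "card L \<noteq> 0" using fin \<open>L \<noteq> {}\<close> by simp
  ultimately consider "card L = 1" | "card L = 2" | "card L = 3" by fastforce
  then show "L \<in> {{vec a b c}} \<union> pair_set ` pair_boxes a b c \<union> triple_set a b c ` triple_box a b c"
  proof cases
    case 1
    then obtain u where u: "L = {u}" by (rule card_1_singletonE)
    then have "u = vec a b c" using sup by (intro poly_mapping_eqI) (auto simp: is_sup_def)
    then show ?thesis using u by simp
  next
    case 2
    then obtain u v where "L = {u, v}" "u \<noteq> v" by (auto simp: card_2_iff)
    then show ?thesis using L pair_in_dominant_setsD by blast
  next
    case 3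
    \<comment> \<open>Three elements use up all three variables, so they can be named by the
      variable in which they dominate.\<close>
    then have onto: "d ` L = UNIV"
      by (intro card_subset_eq) (simp_all add: card_image inj)
    obtain p q r where pqr: "p \<in> L" "q \<in> L" "r \<in> L" "d p = 0" "d q = 1" "d r = 2"
      using onto by (metis UNIV_I imageE)
    have distinct: "p \<noteq> q" "p \<noteq> r" "q \<noteq> r" using pqr by auto
    have "L = {p, q, r}"
      using pqr inj exhaust_type3 by (auto dest: inj_onD) (metis inj_onD)
    obtain p1 p2 p3 where p: "p = vec p1 p2 p3" by (rule expo3_cases)
    obtain q1 q2 q3 where q: "q = vec q1 q2 q3" by (rule expo3_cases)
    obtain r1 r2 r3 where r: "r = vec r1 r2 r3" by (rule expo3_cases)
    have less: "q1 < p1" "r1 < p1" "p2 < q2" "r2 < q2" "p3 < r3" "q3 < r3"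
      using d[of p q] d[of p r] d[of q p] d[of q r] d[of r p] d[of r q] pqr distinct
      by (simp_all add: p q r)
    \<comment> \<open>The maximum in each variable is attained by the vector dominating
      there.\<close>
    have "p1 = a" "q2 = b" "r3 = c"
      using sup less by (auto simp: \<open>L = _\<close> is_sup_def all_type3 p q r)
    then have "L = triple_set a b c ((q1, r1), (p2, r2), (p3, q3))"
      and "((q1, r1), (p2, r2), (p3, q3)) \<in> triple_box a b c"
      using less by (simp_all add: \<open>L = _\<close> p q r triple_set_def triple_box_def)
    then show ?thesis by blast
  qed
next
  fix L
  assume "L \<in> {{vec a b c}} \<union> pair_set ` pair_boxes a b c \<union> triple_set a b c ` triple_box a b c"
  moreover have "{vec a b c} \<in> dominant_sets (vec a b c)"
    by (simp add: dominant_sets_def dominant_set_singleton is_sup_def)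
  ultimately show "L \<in> dominant_sets (vec a b c)"
    using pair_set_in_dominant_sets triple_set_in_dominant_sets by blast
qed

text \<open>The three families are disjoint because their members have one, two and three
  elements.\<close>

lemma card_dominant_sets_vec:
  "card (dominant_sets (vec a b c)) =
    1 + (a * b + a * c + b * c + 3 * a * b * c) + a\<^sup>2 * b\<^sup>2 * c\<^sup>2"
proof -
  let ?P = "pair_set ` pair_boxes a b c" and ?T = "triple_set a b c ` triple_box a b c"
  have "{{vec a b c}} \<inter> ?P = {}"
    using card_pair_set[of _ a b c] by fastforce
  moreover have "({{vec a b c}} \<union> ?P) \<inter> ?T = {}"
    using card_pair_set[of _ a b c] card_triple_set[of _ a b c] by fastforce
  ultimately have "card (dominant_sets (vec a b c)) = card {{vec a b c}} + card ?P + card ?T"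
    unfolding dominant_sets_vec
    by (simp only: card_Un_disjoint finite_Un finite.intros finite_imageI
        finite_pair_boxes finite_triple_box)
  then show ?thesis
    by (simp add: card_image inj_on_pair_set inj_on_triple_set card_pair_boxes card_triple_box)
qed

theorem theorem3p10:
  fixes m1 m2 m3 :: nat
  shows "card {I :: (3, 'k::field) mpoly set. dominant_ideal I \<and>
      ideal_has_lcm I
        (Poly_Mapping.single 0 m1 + Poly_Mapping.single 1 m2 + Poly_Mapping.single 2 m3)} =
    1 + m1\<^sup>2 * m2\<^sup>2 * m3\<^sup>2 + m1 * m2 + m1 * m3 + m2 * m3 + 3 * m1 * m2 * m3"
  by (simp add: card_dominant_ideals card_dominant_sets_vec flip: vec_def)

end
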